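(* Let $n$ be a positive integer divisible by $8$, and let $\mathcal{C}_1\subset\mathcal{C}_2\subset\mathcal{C}_1^\perp$ be binary codes of length $n$ with $\mathcal{C}_1$ doubly even, $\mathbf{1}\in\mathcal{C}_1$, $\dim\mathcal{C}_1=k_1$ and $\dim\mathcal{C}_2=k_1+k_2$. Then the number of quaternary even codes $\mathcal{C}$ of length $n$ containing $\mathbf{1}$ such that $\pi(\mathcal{C})=\mathcal{C}_1$ and $\iota^{-1}(\mathcal{C})=\mathcal{C}_2$ is $2^{(k_1-1)(2n-3k_1-2-2k_2)/2}$.
   Context: $\mathbf{1}$ is the all-ones vector. A quaternary code is a $\mathbf{Z}_4$-submodule of $\mathbf{Z}_4^n$. The Euclidean weight on $\mathbf{Z}_4$ is $\mathrm{wt}_e(0)=0$, $\mathrm{wt}_e(\pm1)=1$, $\mathrm{wt}_e(2)=4$, extended additively; a quaternary code is even if all codewords have Euclidean weight divisible by $8$. $\pi:\mathbf{Z}_4^n\to\mathbf{Z}_2^n$ is reduction mod $2$ and $\iota:\mathbf{Z}_2^n\to\mathbf{Z}_4^n$, $x\mapsto 2x$, is the coordinatewise injection; $\pi(\mathcal{C})$ is the residue code and $\iota^{-1}(\mathcal{C})$ the torsion code. A binary code is doubly even if all Hamming weights are divisible by $4$; duals are with respect to the standard inner product. *)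

theory Defs
  imports "HOL-Analysis.Finite_Cartesian_Product" "HOL-Analysis.Cartesian_Space"
    "HOL-Library.Z2" "HOL-Library.Numeral_Type"
begin

text \<open>
  The ring of integers modulo 4 is the numeral type \<^typ>\<open>4\<close>, the field with two elements is
  \<^typ>\<open>bit\<close>.  Words of length \<open>n\<close> are vectors indexed by a finite type \<open>'n\<close> with
  \<open>CARD('n) = n\<close>; the all-ones word is the vector \<open>1\<close>.
\<close>

type_synonym z4 = 4

lemma module_z4_vec: "module ((*s) :: z4 \<Rightarrow> z4 ^ 'n \<Rightarrow> z4 ^ 'n)"
  by unfold_locales (simp_all add: vector_add_ldistrib vector_sadd_rdistrib vector_smult_assoc)

definition quaternary_code :: "(z4 ^ 'n) set \<Rightarrow> bool" where
  "quaternary_code C \<longleftrightarrow> module.subspace (*s) C"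

definition binary_code :: "(bit ^ 'n) set \<Rightarrow> bool" where
  "binary_code C \<longleftrightarrow> vec.subspace C"

definition euclidean_weight_z4 :: "z4 \<Rightarrow> nat" where
  "euclidean_weight_z4 a = (if a = 0 then 0 else if a = 1 \<or> a = - 1 then 1 else 4)"

definition euclidean_weight :: "z4 ^ 'n \<Rightarrow> nat" where
  "euclidean_weight x = (\<Sum>i\<in>UNIV. euclidean_weight_z4 (x $ i))"

definition even_code :: "(z4 ^ 'n) set \<Rightarrow> bool" where
  "even_code C \<longleftrightarrow> quaternary_code C \<and> (\<forall>x\<in>C. 8 dvd euclidean_weight x)"

definition hamming_weight :: "bit ^ 'n \<Rightarrow> nat" where
  "hamming_weight x = card {i. x $ i \<noteq> 0}"

definition doubly_even :: "(bit ^ 'n) set \<Rightarrow> bool" where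
  "doubly_even C \<longleftrightarrow> binary_code C \<and> (\<forall>x\<in>C. 4 dvd hamming_weight x)"

definition dual_code :: "(bit ^ 'n) set \<Rightarrow> (bit ^ 'n) set" where
  "dual_code C = {y. \<forall>x\<in>C. (\<Sum>i\<in>UNIV. x $ i * y $ i) = 0}"

text \<open>\<^const>\<open>Rep_bit0\<close> yields the representative in \<open>{0..<4}\<close>.\<close>

definition red2 :: "z4 \<Rightarrow> bit" where
  "red2 a = of_int (Rep_bit0 a)"

text \<open>\<open>of_bool (b = 1)\<close> is the lift of \<open>b\<close> to \<open>{0, 1}\<close>.\<close>

definition double :: "bit \<Rightarrow> z4" where
  "double b = 2 * of_bool (b = 1)"

definition reduction :: "z4 ^ 'n \<Rightarrow> bit ^ 'n" where
  "reduction x = (\<chi> i. red2 (x $ i))"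

definition injection :: "bit ^ 'n \<Rightarrow> z4 ^ 'n" where
  "injection x = (\<chi> i. double (x $ i))"

definition residue_code :: "(z4 ^ 'n) set \<Rightarrow> (bit ^ 'n) set" where
  "residue_code C = reduction ` C"

definition torsion_code :: "(z4 ^ 'n) set \<Rightarrow> (bit ^ 'n) set" where
  "torsion_code C = injection -` C"

end

theory Submission
  imports Defs
begin

text \<open>
  Fix the torsion code \<open>D = C\<^sub>2\<close> and let the residue code grow from \<open>{0, 1}\<close> to \<open>C\<^sub>1\<close> by one
  basis vector at a time.  For residue code \<open>E\<close> and \<open>a \<notin> E\<close>, an even code \<open>C'\<close> with residue code
  \<open>E' = E \<union> (a + E)\<close> is \<open>C \<union> (u + C)\<close>, where \<open>C\<close> is the part of \<open>C'\<close> above \<open>E\<close> and \<open>u\<close> is any of the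
  \<open>|D|\<close> elements of \<open>C'\<close> above \<open>a\<close>.  Conversely, given \<open>C\<close>, a lift \<open>u\<close> of \<open>a\<close> can be adjoined iff its
  weight is divisible by 8 and it is orthogonal to \<open>C\<close>.  Replacing \<open>u\<close> by \<open>u + 2y\<close> changes these
  conditions by the values of \<open>y\<close> as a linear functional on \<open>E'\<close>, so exactly \<open>2\<^sup>n / |E'|\<close>
  lifts work.  Hence each step multiplies the number of codes by \<open>2\<^sup>n / (|E'| |D|)\<close>.
\<close>

section \<open>Residues modulo 4, their doubling, and weights modulo 8\<close>

lemma z4_cases: "a = 0 \<or> a = 1 \<or> a = 2 \<or> a = 3" for a :: z4
  using forall_4[of "\<lambda>a. a = 0 \<or> a = 1 \<or> a = 2 \<or> a = 3"] by auto

lemma z4_numerals: "(4::z4) = 0" "(5::z4) = 1" "(6::z4) = 2" "(9::z4) = 1"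
  by simp_all

lemma z8_numerals: "(8::8) = 0" "(9::8) = 1" "(10::8) = 2" "(12::8) = 4"
  by simp_all

text \<open>Twice an integer modulo 4 is well defined modulo 8.\<close>

definition double_z8 :: "z4 \<Rightarrow> 8" where
  "double_z8 a = of_int (2 * Rep_bit0 a)"

lemma double_z8_simps [simp]:
  "double_z8 0 = 0" "double_z8 1 = 2" "double_z8 2 = 4" "double_z8 3 = 6"
  by (simp_all add: double_z8_def bit0.Rep_0 bit0.Rep_1 bit0.Rep_numeral)

lemma red2_simps [simp]: "red2 0 = 0" "red2 1 = 1" "red2 2 = 0" "red2 3 = 1"
  by (simp_all add: red2_def bit0.Rep_0 bit0.Rep_1 bit0.Rep_numeral)

lemma euclidean_weight_z4_simps [simp]:
  "euclidean_weight_z4 0 = 0" "euclidean_weight_z4 1 = 1"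
  "euclidean_weight_z4 2 = 4" "euclidean_weight_z4 3 = 1"
  by (simp_all add: euclidean_weight_z4_def)

lemma double_simps [simp]: "double 0 = 0" "double 1 = 2"
  by (simp_all add: double_def)

lemma double_z8_add: "double_z8 (a + b) = double_z8 a + double_z8 b"
  using z4_cases[of a] z4_cases[of b] by (auto simp: z4_numerals z8_numerals)

lemma double_z8_eq_0_iff: "double_z8 a = 0 \<longleftrightarrow> a = 0"
  using z4_cases[of a] by auto

lemma red2_add: "red2 (a + b) = red2 a + red2 b"
  using z4_cases[of a] z4_cases[of b] by (auto simp: z4_numerals z8_numerals)

lemma red2_mult: "red2 (a * b) = red2 a * red2 b"
  using z4_cases[of a] z4_cases[of b] by (auto simp: z4_numerals z8_numerals)

lemma double_add: "double (b + c) = double b + double c"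
  by (cases b; cases c) auto

lemma double_eq_0_iff: "double b = 0 \<longleftrightarrow> b = 0"
  by (cases b) auto

lemma red2_double: "red2 (double b) = 0"
  by (cases b) auto

lemma red2_eq_0E:
  assumes "red2 a = 0" obtains b where "a = double b"
  using assms z4_cases[of a] by (metis double_simps red2_simps(2,4) zero_neq_one)

lemma double_mult_red2: "double (b * red2 a) = double b * a"
  using z4_cases[of a] by (cases b) auto

lemma add_self_z4: "a + a = double (red2 a)" for a :: z4
  using z4_cases[of a] by auto

text \<open>The weight of \<open>a\<close> is \<open>a\<^sup>2\<close> modulo 8, and \<open>2 a b\<close> modulo 8 only depends on \<open>a b\<close> modulo 4.\<close>

lemma euclidean_weight_z4_add:
  "(of_nat (euclidean_weight_z4 (a + b)) :: 8) =
    of_nat (euclidean_weight_z4 a) + of_nat (euclidean_weight_z4 b) + double_z8 (a * b)"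
  using z4_cases[of a] z4_cases[of b] by (auto simp: z4_numerals z8_numerals)

text \<open>The weight of 2 is 4, which is twice 2. In this form it combines with the
  \<open>double_z8\<close> term in the weight of a sum.\<close>

lemma euclidean_weight_z4_double: "of_nat (euclidean_weight_z4 (double b)) = double_z8 (double b)"
  by (cases b) auto

lemma euclidean_weight_z4_mod_4: "euclidean_weight_z4 a mod 4 = of_bool (red2 a \<noteq> 0)"
  using z4_cases[of a] by auto

lemma of_nat_z8_eq_0_iff: "(of_nat m :: 8) = 0 \<longleftrightarrow> 8 dvd m"
  by (simp add: of_nat_eq_0_iff_char_dvd)

section \<open>Words: reduction, injection and inner products\<close>

lemma reduction_add: "reduction (x + y) = reduction x + reduction y"
  by (simp add: reduction_def vec_eq_iff red2_add)

lemma reduction_0 [simp]: "reduction 0 = 0" and reduction_1 [simp]: "reduction 1 = 1"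
  by (simp_all add: reduction_def vec_eq_iff)

lemma injection_add: "injection (x + y) = injection x + injection y"
  by (simp only: injection_def vec_eq_iff vec_lambda_beta vector_add_component double_add) simp

lemma injection_0 [simp]: "injection 0 = 0"
  by (simp add: injection_def vec_eq_iff)

lemma inj_injection: "inj injection"
proof (rule injI)
  fix x y :: "bit ^ 'n" assume eq: "injection x = injection y"
  have "x $ i = y $ i" for i
    using vec_eq_iff[THEN iffD1, OF eq, rule_format, of i]
    by (cases "x $ i"; cases "y $ i") (auto simp: injection_def)
  then show "x = y" by (simp add: vec_eq_iff)
qed

lemma reduction_injection [simp]: "reduction (injection x) = 0"
  by (simp add: reduction_def injection_def vec_eq_iff red2_double)

lemma reduction_eq_0E:
  assumes "reduction x = 0" obtains d where "x = injection d"
proof -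
  have "\<exists>b. x $ i = double b" for i
    using assms red2_eq_0E[of "x $ i"] by (auto simp: reduction_def vec_eq_iff)
  then obtain f where "\<And>i. x $ i = double (f i)" by metis
  then have "x = injection (\<chi> i. f i)" by (simp add: injection_def vec_eq_iff)
  then show thesis by (rule that)
qed

lemma surj_reduction: "surj reduction"
proof (rule surjI)
  fix x :: "bit ^ 'n"
  show "reduction (\<chi> i. of_bool (x $ i = 1)) = x"
    by (simp add: reduction_def vec_eq_iff)
qed

text \<open>The library does not make \<^typ>\<open>bit\<close> an instance of \<^class>\<open>finite\<close>.\<close>

lemma finite_bit_vec [simp]: "finite A" for A :: "(bit ^ 'n) set"
  by (rule finite_subset[OF subset_UNIV]) (metis finite_imageI finite_class.finite_UNIV surj_reduction)

text \<open>Because of this, a lift of \<open>a\<close> can lie in a code only if \<open>a\<close>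
  lies in the torsion code.\<close>

lemma add_self_z4_vec: "x + x = injection (reduction x)" for x :: "z4 ^ 'n"
  by (simp only: injection_def reduction_def vec_eq_iff vec_lambda_beta vector_add_component add_self_z4) simp

lemma add_self_bit_vec: "x + x = 0" for x :: "bit ^ 'n"
  by (simp add: vec_eq_iff)

lemma minus_bit_vec: "x - y = x + y" for x y :: "bit ^ 'n"
  by (simp add: vec_eq_iff)

lemma reduction_diff: "reduction (x - y) = reduction x + reduction y"
  using reduction_add[of "x - y" y] by (simp add: add.assoc add_self_bit_vec)

definition z4_inner :: "z4 ^ 'n \<Rightarrow> z4 ^ 'n \<Rightarrow> z4" where
  "z4_inner x y = (\<Sum>i\<in>UNIV. x $ i * y $ i)"

definition bit_inner :: "bit ^ 'n \<Rightarrow> bit ^ 'n \<Rightarrow> bit" where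
  "bit_inner x y = (\<Sum>i\<in>UNIV. x $ i * y $ i)"

lemma dual_code_iff: "y \<in> dual_code C \<longleftrightarrow> (\<forall>x\<in>C. bit_inner x y = 0)"
  by (simp add: dual_code_def bit_inner_def)

lemma z4_inner_add_left: "z4_inner (x + y) z = z4_inner x z + z4_inner y z"
  and z4_inner_add_right: "z4_inner x (y + z) = z4_inner x y + z4_inner x z"
  and z4_inner_0_right [simp]: "z4_inner x 0 = 0"
  by (simp_all add: z4_inner_def algebra_simps sum.distrib)

lemma bit_inner_add_left: "bit_inner (x + y) z = bit_inner x z + bit_inner y z"
  and bit_inner_add_right: "bit_inner x (y + z) = bit_inner x y + bit_inner x z"
  and bit_inner_0_right [simp]: "bit_inner x 0 = 0"
  by (simp_all only: bit_inner_def vector_add_component zero_index distrib_left distrib_right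
      sum.distrib mult_zero_right sum.neutral_const)

lemma bit_inner_commute: "bit_inner x y = bit_inner y x"
  unfolding bit_inner_def by (intro sum.cong refl mult.commute)

lemma z4_inner_commute: "z4_inner x y = z4_inner y x"
  by (simp add: z4_inner_def mult.commute)

lemma double_sum: "double (sum f A) = (\<Sum>i\<in>A. double (f i))"
  by (induction A rule: infinite_finite_induct) (simp_all add: double_add del: add_bit_eq_xor)

lemma red2_sum: "red2 (sum f A) = (\<Sum>i\<in>A. red2 (f i))"
  by (induction A rule: infinite_finite_induct) (simp_all add: red2_add)

lemma double_z8_sum: "double_z8 (sum f A) = (\<Sum>i\<in>A. double_z8 (f i))"
  by (induction A rule: infinite_finite_induct) (simp_all add: double_z8_add)

text \<open>Doubling erases all of \<open>x\<close> but its residue. This turns a change of lift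
  into a binary linear functional.\<close>

lemma z4_inner_injection: "z4_inner (injection y) x = double (bit_inner y (reduction x))"
  by (simp only: z4_inner_def bit_inner_def injection_def reduction_def vec_lambda_beta
      double_sum double_mult_red2)

lemma red2_z4_inner: "red2 (z4_inner x y) = bit_inner (reduction x) (reduction y)"
  by (simp add: z4_inner_def bit_inner_def reduction_def red2_sum red2_mult)

text \<open>Modulo 8 the Euclidean weight is the sum of squares; this is the polarisation identity
  of that quadratic form.\<close>

lemma euclidean_weight_add:
  "(of_nat (euclidean_weight (x + y)) :: 8) =
    of_nat (euclidean_weight x) + of_nat (euclidean_weight y) + double_z8 (z4_inner x y)"
  by (simp add: euclidean_weight_def z4_inner_def euclidean_weight_z4_add double_z8_sum sum.distrib)

text \<open>The weight is 4 times the Hamming weight of \<open>y\<close>, so modulo 8 only its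
  parity matters, which is the inner product with \<open>1\<close>.\<close>

lemma euclidean_weight_injection:
  "of_nat (euclidean_weight (injection y)) = double_z8 (double (bit_inner y 1))"
  by (simp only: euclidean_weight_def injection_def vec_lambda_beta of_nat_sum
      euclidean_weight_z4_double bit_inner_def one_index mult_1_right double_sum double_z8_sum)

text \<open>Squares are 0 or 1 modulo 4 according to parity.\<close>

lemma euclidean_weight_mod_4: "euclidean_weight x mod 4 = hamming_weight (reduction x) mod 4"
proof -
  have "euclidean_weight x mod 4 = (\<Sum>i\<in>UNIV. euclidean_weight_z4 (x $ i) mod 4) mod 4"
    by (simp add: euclidean_weight_def mod_sum_eq)
  also have "(\<Sum>i\<in>UNIV. euclidean_weight_z4 (x $ i) mod 4) = hamming_weight (reduction x)"
    by (simp add: euclidean_weight_z4_mod_4 hamming_weight_def reduction_def)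
  finally show ?thesis .
qed

lemma euclidean_weight_1 [simp]: "euclidean_weight (1 :: z4 ^ 'n) = CARD('n)"
  by (simp add: euclidean_weight_def)

section \<open>Quaternary codes: closure and self-orthogonality\<close>

text \<open>Every scalar in \<open>z4\<close> is a repeated sum of 1, so additive closure already
  gives scalar multiples.\<close>

lemma quaternary_code_iff:
  "quaternary_code C \<longleftrightarrow> 0 \<in> C \<and> (\<forall>x\<in>C. \<forall>y\<in>C. x + y \<in> C)"
proof -
  have "k *s x \<in> C" if "0 \<in> C" "\<And>x y. x \<in> C \<Longrightarrow> y \<in> C \<Longrightarrow> x + y \<in> C" "x \<in> C" for k x
  proof -
    have "k *s x = 0 \<or> k *s x = x \<or> k *s x = x + x \<or> k *s x = x + x + x"
      using z4_cases[of k] by (auto simp: vec_eq_iff)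
    with that show ?thesis by metis
  qed
  then show ?thesis
    unfolding quaternary_code_def module.subspace_def[OF module_z4_vec] by blast
qed

lemma quaternary_code_diff:
  assumes "quaternary_code C" "x \<in> C" "y \<in> C" shows "x - y \<in> C"
proof -
  have "x - y = x + (y + y + y)"
    by (simp add: vec_eq_iff algebra_simps z4_numerals)
  with assms show ?thesis unfolding quaternary_code_iff by metis
qed

text \<open>By polarisation: the three weights vanish modulo 8, and doubling from modulo 4 to modulo
  8 is injective.\<close>

lemma even_code_self_orthogonal:
  assumes "even_code C" "x \<in> C" "y \<in> C" shows "z4_inner x y = 0"
proof -
  have "8 dvd euclidean_weight x" "8 dvd euclidean_weight y" "8 dvd euclidean_weight (x + y)"
    using assms by (auto simp: even_code_def quaternary_code_iff)
  then show ?thesis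
    using euclidean_weight_add[of x y] by (simp add: double_z8_eq_0_iff flip: of_nat_z8_eq_0_iff)
qed

section \<open>Binary spans, their sizes and their duals\<close>

lemma span_insert_bit:
  "vec.span (insert a B) = vec.span B \<union> (+) a ` vec.span B" for a :: "bit ^ 'n"
proof -
  have "(\<exists>k. x - k *s a \<in> vec.span B) \<longleftrightarrow> x \<in> vec.span B \<or> x - a \<in> vec.span B" for x
  proof -
    have "(\<exists>k. x - k *s a \<in> vec.span B) \<longleftrightarrow> (\<exists>k\<in>{0, 1}. x - k *s a \<in> vec.span B)"
      by (metis bit.exhaust insertCI)
    then show ?thesis by simp
  qed
  moreover have "x \<in> (+) a ` S \<longleftrightarrow> x - a \<in> S" for x S
    by (auto simp: image_iff) (metis diff_add_cancel add.commute)
  ultimately show ?thesis by (auto simp: vec.span_insert)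
qed

lemma card_Un_translate:
  fixes A :: "(bit ^ 'n) set"
  assumes "A \<inter> (+) a ` A = {}" shows "card (A \<union> (+) a ` A) = 2 * card A"
  using assms by (simp add: card_Un_disjoint card_image)

lemma card_span_bit:
  fixes B :: "(bit ^ 'n) set"
  assumes "vec.independent B" shows "card (vec.span B) = 2 ^ card B"
proof -
  have "finite B" by simp
  then show ?thesis using assms
  proof (induction B)
    case (insert a B)
    then have a: "a \<notin> vec.span B" "vec.independent B"
      by (simp_all add: vec.independent_insert)
    have "vec.span B \<inter> (+) a ` vec.span B = {}"
      using a(1) by (auto simp: vec.span_add_eq2)
    with insert a show ?case by (simp add: span_insert_bit card_Un_translate)
  qed simp
qed

lemma card_subspace_bit:
  fixes D :: "(bit ^ 'n) set"
  assumes "vec.subspace D" shows "card D = 2 ^ vec.dim D"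
  using vec.basis_subspace_exists[OF assms] card_span_bit by metis

text \<open>Values on an independent set extend to a linear functional. The map \<open>g\<close>
  repeats it in every coordinate, so any row of the matrix of \<open>g\<close> represents it as an
  inner product.\<close>

lemma independent_bit_inner_extend:
  fixes B :: "(bit ^ 'n) set"
  assumes "vec.independent B" obtains y where "\<And>b. b \<in> B \<Longrightarrow> bit_inner y b = h b"
proof -
  obtain g :: "bit ^ 'n \<Rightarrow> bit ^ 'n" where g: "Vector_Spaces.linear (*s) (*s) g"
    "\<forall>b\<in>B. g b = (\<chi> i. h b)"
    using vec.linear_independent_extend[OF assms, of "\<lambda>b. \<chi> i. h b"] by blast
  fix i :: 'n
  have "bit_inner (matrix g $ i) b = h b" if "b \<in> B" for b
  proof -
    have "bit_inner (matrix g $ i) b = (matrix g *v b) $ i"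
      by (simp only: bit_inner_def matrix_vector_mult_def vec_lambda_beta)
    with g that show ?thesis by (simp add: matrix_works)
  qed
  then show thesis by (rule that)
qed

lemma dual_code_span: "y \<in> dual_code (vec.span B) \<longleftrightarrow> (\<forall>b\<in>B. bit_inner b y = 0)"
proof
  assume *: "\<forall>b\<in>B. bit_inner b y = 0"
  have "vec.subspace {x. bit_inner x y = 0}"
  proof (rule vec.subspaceI)
    show "c *s x \<in> {x. bit_inner x y = 0}" if "x \<in> {x. bit_inner x y = 0}" for c x
      using that by (cases c) (auto simp: bit_inner_commute[of _ y])
  qed (auto simp: bit_inner_add_left bit_inner_commute[of 0 y])
  with * have "vec.span B \<subseteq> {x. bit_inner x y = 0}"
    by (intro vec.span_minimal) auto
  then show "y \<in> dual_code (vec.span B)" by (auto simp: dual_code_iff)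
qed (auto simp: dual_code_iff intro: vec.span_base)

text \<open>Each new independent vector \<open>a\<close> halves the dual: some \<open>z\<close> is
  orthogonal to \<open>B\<close> but not to \<open>a\<close>, and translation by \<open>z\<close>
  exchanges the words orthogonal to \<open>a\<close> with the others.\<close>

lemma card_dual_code_span:
  fixes B :: "(bit ^ 'n) set"
  assumes "vec.independent B"
  shows "card (dual_code (vec.span B)) * 2 ^ card B = 2 ^ CARD('n)"
proof -
  have "finite B" by simp
  then show ?thesis using assms
  proof (induction B)
    case empty
    have "dual_code (vec.span {}) = (UNIV :: (bit ^ 'n) set)"
      by (auto simp: dual_code_iff bit_inner_commute[of 0])
    then show ?case
      using card_subspace_bit[OF vec.subspace_UNIV] by (simp only: vec_dim_card card.empty power_0 mult_1_right)
  next
    case (insert a B)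
    obtain z where z: "\<And>b. b \<in> insert a B \<Longrightarrow> bit_inner z b = of_bool (b = a)"
      using independent_bit_inner_extend[OF insert.prems, of "\<lambda>b. of_bool (b = a)"] by metis
    let ?N = "dual_code (vec.span (insert a B))"
    have N: "y \<in> ?N \<longleftrightarrow> y \<in> dual_code (vec.span B) \<and> bit_inner a y = 0" for y
      by (auto simp: dual_code_span)
    have "z \<in> dual_code (vec.span B)"
      using z insert.hyps by (auto simp: dual_code_span bit_inner_commute[of _ z])
    then have shift: "z + y \<in> dual_code (vec.span B) \<longleftrightarrow> y \<in> dual_code (vec.span B)" for y
      by (simp add: dual_code_span bit_inner_add_right)
    have az: "bit_inner a (z + y) = 1 + bit_inner a y" for y
      using z[of a] by (simp add: bit_inner_add_right bit_inner_commute[of a z])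
    have "dual_code (vec.span B) = ?N \<union> (+) z ` ?N"
    proof (intro set_eqI iffI)
      fix y assume y: "y \<in> dual_code (vec.span B)"
      have "y = z + (z + y)" by (simp add: add.assoc[symmetric] add_self_bit_vec)
      moreover have "y \<in> ?N \<or> z + y \<in> ?N"
        using y N[of y] N[of "z + y"] shift[of y] az[of y] by (cases "bit_inner a y") auto
      ultimately show "y \<in> ?N \<union> (+) z ` ?N" by blast
    qed (auto simp: N shift)
    moreover have "?N \<inter> (+) z ` ?N = {}"
      using az by (auto simp: N)
    ultimately have "card (dual_code (vec.span B)) = 2 * card ?N"
      by (metis card_Un_translate)
    with insert show ?case by (simp add: vec.independent_insert)
  qed
qed

section \<open>Adjoining a lift to an even code and restricting back\<close>

text \<open>Membership of \<open>1\<close> is imposed separately, because the base case starts from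
  a code with residue code \<open>{0}\<close>, which cannot contain it.\<close>

definition even_lifts :: "(bit ^ 'n) set \<Rightarrow> (bit ^ 'n) set \<Rightarrow> (z4 ^ 'n) set set" where
  "even_lifts E D = {C. even_code C \<and> residue_code C = E \<and> torsion_code C = D}"

text \<open>Two cosets suffice: \<open>u + u\<close> is the doubled residue of \<open>u\<close>,
  already in \<open>C\<close> because that residue lies in \<open>D\<close>. Evenness follows by
  polarisation.\<close>

lemma even_lift_adjoin:
  fixes u :: "z4 ^ 'n"
  assumes C: "C \<in> even_lifts E D"
    and u: "reduction u \<notin> E" "reduction u \<in> D" "8 dvd euclidean_weight u"
    and orth: "\<And>c. c \<in> C \<Longrightarrow> z4_inner u c = 0"
  shows "C \<union> (+) u ` C \<in> even_lifts (E \<union> (+) (reduction u) ` E) D"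
proof -
  have code: "0 \<in> C" "\<And>x y. x \<in> C \<Longrightarrow> y \<in> C \<Longrightarrow> x + y \<in> C"
    and even: "\<And>x. x \<in> C \<Longrightarrow> 8 dvd euclidean_weight x"
    and res: "residue_code C = E" and tor: "torsion_code C = D"
    using C by (auto simp: even_lifts_def even_code_def quaternary_code_iff)
  have uu: "u + u \<in> C"
    using u(2) tor by (auto simp: add_self_z4_vec torsion_code_def)
  have "quaternary_code (C \<union> (+) u ` C)"
    unfolding quaternary_code_iff
  proof (intro conjI ballI)
    fix x y assume "x \<in> C \<union> (+) u ` C" "y \<in> C \<union> (+) u ` C"
    then consider "x \<in> C" "y \<in> C" | c where "x = u + c" "c \<in> C" "y \<in> C"
      | d where "x \<in> C" "y = u + d" "d \<in> C"
      | c d where "x = u + c" "c \<in> C" "y = u + d" "d \<in> C" by blast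
    then show "x + y \<in> C \<union> (+) u ` C"
    proof cases
      case 1
      then show ?thesis by (simp add: code)
    next
      case 2
      then have "x + y = u + (c + y)" by (simp add: ac_simps)
      with 2 show ?thesis by (simp add: code)
    next
      case 3
      then have "x + y = u + (x + d)" by (simp add: ac_simps)
      with 3 show ?thesis by (simp add: code)
    next
      case 4
      then have "x + y = (u + u) + (c + d)" by (simp add: ac_simps)
      with 4 show ?thesis by (metis UnI1 code(2) uu)
    qed
  qed (simp add: code)
  moreover have "8 dvd euclidean_weight x" if "x \<in> C \<union> (+) u ` C" for x
  proof -
    have "8 dvd euclidean_weight (u + c)" if "c \<in> C" for c
      using euclidean_weight_add[of u c] u(3) even[OF that] orth[OF that]
      by (simp flip: of_nat_z8_eq_0_iff)
    with that even show ?thesis by auto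
  qed
  moreover have "residue_code (C \<union> (+) u ` C) = E \<union> (+) (reduction u) ` E"
    using res by (auto simp: residue_code_def image_Un image_image reduction_add)
  moreover have "torsion_code (C \<union> (+) u ` C) = D"
  proof -
    \<comment> \<open>The new coset contributes no torsion: its words have nonzero residue, as
      \<open>reduction u\<close> lies outside \<open>E\<close>.\<close>
    have "injection d \<notin> (+) u ` C" for d
    proof
      assume "injection d \<in> (+) u ` C"
      then obtain c where c: "c \<in> C" "injection d = u + c" by blast
      then have "reduction u = reduction c"
        using reduction_injection[of d] reduction_add[of u c] minus_bit_vec[of "reduction u" "reduction c"]
        by (metis eq_iff_diff_eq_0)
      with c u(1) res show False by (auto simp: residue_code_def)
    qed
    with tor show ?thesis by (auto simp: torsion_code_def)
  qed
  ultimately show ?thesis by (simp add: even_lifts_def even_code_def)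
qed

text \<open>Doubled words have residue 0, which lies in \<open>E\<close>, so the torsion code
  survives the restriction.\<close>

lemma even_lift_restrict:
  assumes C: "C \<in> even_lifts E' D" and E: "vec.subspace E" "E \<subseteq> E'"
  shows "C \<inter> reduction -` E \<in> even_lifts E D"
proof -
  have "residue_code (C \<inter> reduction -` E) = residue_code C \<inter> E"
    by (auto simp: residue_code_def)
  with C E(2) have "residue_code (C \<inter> reduction -` E) = E"
    by (auto simp: even_lifts_def)
  moreover have "torsion_code (C \<inter> reduction -` E) = torsion_code C"
    using vec.subspace_0[OF E(1)] by (auto simp: torsion_code_def)
  ultimately show ?thesis
    using C vec.subspace_add[OF E(1)] vec.subspace_0[OF E(1)]
    by (auto simp: even_lifts_def even_code_def quaternary_code_iff reduction_add)
qed

section \<open>Fibres of reduction and admissible lifts\<close>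

text \<open>The kernel of reduction on \<open>C\<close> is the doubled torsion code, and nonempty
  fibres are its cosets.\<close>

lemma torsion_coset:
  assumes "quaternary_code C" "u \<in> C"
  shows "{v \<in> C. reduction v = reduction u} = (\<lambda>d. u + injection d) ` torsion_code C"
proof (intro set_eqI iffI)
  fix v assume v: "v \<in> {v \<in> C. reduction v = reduction u}"
  then have "reduction (v - u) = 0"
    by (simp add: reduction_diff add_self_bit_vec)
  then obtain d where d: "v - u = injection d" by (rule reduction_eq_0E)
  with assms v have "d \<in> torsion_code C"
    using quaternary_code_diff[of C v u] by (auto simp: torsion_code_def)
  moreover have "v = u + injection d" using d by (simp add: algebra_simps)
  ultimately show "v \<in> (\<lambda>d. u + injection d) ` torsion_code C" by blast
qed (use assms in \<open>auto simp: torsion_code_def quaternary_code_iff reduction_add\<close>)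

lemma card_torsion_coset:
  assumes "quaternary_code C" "a \<in> residue_code C"
  shows "card {v \<in> C. reduction v = a} = card (torsion_code C)"
proof -
  obtain u where u: "u \<in> C" "a = reduction u"
    using assms(2) by (auto simp: residue_code_def)
  have "inj_on (\<lambda>d. u + injection d) (torsion_code C)"
    using inj_injection by (auto simp: inj_on_def)
  with u show ?thesis
    by (simp add: torsion_coset[OF assms(1)] card_image)
qed

text \<open>The conditions of \<open>even_lift_adjoin\<close> that depend on the lift itself and not
  only on its residue.\<close>

definition admissible :: "(z4 ^ 'n) set \<Rightarrow> (z4 ^ 'n) set" where
  "admissible C = {u. 8 dvd euclidean_weight u \<and> (\<forall>c\<in>C. z4_inner u c = 0)}"

text \<open>Different \<open>u\<close> may produce the same larger code, so each code is paired with
  a marked lift of \<open>a\<close>. Restricting to residues in \<open>E\<close> then undoes the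
  adjoining.\<close>

lemma bij_betw_adjoin:
  fixes a :: "bit ^ 'n"
  assumes E: "vec.subspace E" "1 \<in> E" and a: "a \<notin> E" "a \<in> D"
  defines "E' \<equiv> E \<union> (+) a ` E"
  shows "bij_betw (\<lambda>(C, u). (C \<union> (+) u ` C, u))
    (SIGMA C : {C \<in> even_lifts E D. 1 \<in> C}. {u \<in> admissible C. reduction u = a})
    (SIGMA C : {C \<in> even_lifts E' D. 1 \<in> C}. {u \<in> C. reduction u = a})"
    (is "bij_betw ?f ?A ?B")
proof (rule bij_betw_byWitness[where f' = "\<lambda>(C, u). (C \<inter> reduction -` E, u)"])
  have EI: "a + e \<notin> E" if "e \<in> E" for e
    using that a(1) vec.subspace_diff[OF E(1)] by (metis add_diff_cancel_right')
  have res: "reduction c \<in> E" if "C \<in> even_lifts E D" "c \<in> C" for C c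
    using that by (auto simp: even_lifts_def residue_code_def)
  show "\<forall>p\<in>?A. (\<lambda>(C, u). (C \<inter> reduction -` E, u)) (?f p) = p"
    using res EI by (fastforce simp: reduction_add)
  have glue: "C \<inter> reduction -` E \<union> (+) u ` (C \<inter> reduction -` E) = C"
    if C: "C \<in> even_lifts E' D" and u: "u \<in> C" "reduction u = a" for C u
  proof -
    have code: "quaternary_code C" using C by (simp add: even_lifts_def even_code_def)
    \<comment> \<open>A residue outside \<open>E\<close> lies in \<open>a + E\<close>, and
      subtracting \<open>u\<close> moves it into \<open>E\<close>.\<close>
    have "x \<in> (+) u ` (C \<inter> reduction -` E)" if x: "x \<in> C" "reduction x \<notin> E" for x
    proof -
      obtain e where e: "e \<in> E" "reduction x = a + e"
        using C x by (auto simp: even_lifts_def residue_code_def E'_def)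
      have "reduction (x - u) = e + (a + a)"
        unfolding reduction_diff e u by (simp only: ac_simps)
      then have "x - u \<in> C \<inter> reduction -` E"
        using quaternary_code_diff[OF code x(1) u(1)] e by (simp add: add_self_bit_vec)
      then show ?thesis by (rule rev_image_eqI) simp
    qed
    moreover have "u + c \<in> C" if "c \<in> C" for c
      using code that u by (simp add: quaternary_code_iff)
    ultimately show ?thesis by auto
  qed
  then show "\<forall>p\<in>?B. ?f ((\<lambda>(C, u). (C \<inter> reduction -` E, u)) p) = p"
    by clarsimp
  have "C \<union> (+) u ` C \<in> even_lifts E' D" "u \<in> (+) u ` C"
    if C: "C \<in> even_lifts E D" and u: "u \<in> admissible C" "reduction u = a" for C u
  proof -
    show "C \<union> (+) u ` C \<in> even_lifts E' D"
      using even_lift_adjoin[OF C, of u] a u by (auto simp: admissible_def E'_def)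
    have "0 \<in> C" using C by (simp add: even_lifts_def even_code_def quaternary_code_iff)
    then show "u \<in> (+) u ` C" by (rule rev_image_eqI) simp
  qed
  then show "?f ` ?A \<subseteq> ?B" by auto
  have "C \<inter> reduction -` E \<in> even_lifts E D" "u \<in> admissible (C \<inter> reduction -` E)"
    if C: "C \<in> even_lifts E' D" and u: "u \<in> C" for C u
  proof -
    show "C \<inter> reduction -` E \<in> even_lifts E D"
      using even_lift_restrict[OF C E(1)] by (auto simp: E'_def)
    have "even_code C" using C by (simp add: even_lifts_def)
    with u show "u \<in> admissible (C \<inter> reduction -` E)"
      by (auto simp: admissible_def even_code_self_orthogonal) (auto simp: even_code_def)
  qed
  then show "(\<lambda>(C, u). (C \<inter> reduction -` E, u)) ` ?B \<subseteq> ?A"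
    using E(2) by auto
qed

text \<open>The admissible lifts form one translate of the doubled dual code: correcting an
  arbitrary lift \<open>u\<close> gives one solution \<open>w\<close>, and the others are
  \<open>w + injection y\<close>.\<close>

lemma card_admissible:
  fixes a :: "bit ^ 'n"
  assumes B: "vec.independent (insert a B)" "a \<notin> B" "1 \<in> B"
    and C: "C \<in> even_lifts (vec.span B) D"
    and D: "D \<subseteq> dual_code (vec.span (insert a B))"
    and orth: "a \<in> dual_code (vec.span B)" and wt: "4 dvd hamming_weight a"
  shows "card {u \<in> admissible C. reduction u = a} = card (dual_code (vec.span (insert a B)))"
proof -
  have code: "quaternary_code C" and even: "even_code C" and res: "residue_code C = vec.span B"
    and tor: "torsion_code C = D"
    using C by (auto simp: even_lifts_def even_code_def)
  obtain u where u: "reduction u = a" using surj_reduction by (metis surjD)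
  have Da: "bit_inner a d = 0" if "d \<in> D" for d
    using that D by (auto simp: dual_code_iff vec.span_base)
  \<comment> \<open>Adding \<open>2y\<close> changes the weight by 4 times the value of
    \<open>y\<close> on \<open>1 + a\<close>: the \<open>1\<close> stems from the weight of
    \<open>2y\<close>, the \<open>a\<close> from the polar term.\<close>
  have wt_shift: "(of_nat (euclidean_weight (v + injection y)) :: 8) =
      of_nat (euclidean_weight v) + double_z8 (double (bit_inner y 1 + bit_inner y a))"
    if "reduction v = a" for v y
    using that unfolding euclidean_weight_add euclidean_weight_injection z4_inner_commute[of v]
      z4_inner_injection double_add double_z8_add by simp
  have "\<exists>f. \<forall>b\<in>B. f b \<in> C \<and> reduction (f b) = b"
  proof (intro bchoice ballI)
    fix b assume "b \<in> B"
    then have "b \<in> residue_code C" by (simp add: res vec.span_base)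
    then show "\<exists>c. c \<in> C \<and> reduction c = b" by (auto simp: residue_code_def)
  qed
  then obtain f where f: "\<And>b. b \<in> B \<Longrightarrow> f b \<in> C" "\<And>b. b \<in> B \<Longrightarrow> reduction (f b) = b"
    by blast
  text \<open>
    The inner products of \<open>u\<close> with lifts of the basis are even, and its weight is divisible by 4, so
    both defects can be removed by adding an element \<open>2y\<close> with prescribed values on the basis.
  \<close>
  have "\<exists>h. \<forall>b\<in>B. z4_inner u (f b) = double (h b)"
  proof (intro bchoice ballI)
    fix b assume "b \<in> B"
    then have "red2 (z4_inner u (f b)) = 0"
      using orth f u by (simp add: red2_z4_inner dual_code_span bit_inner_commute[of a])
    then show "\<exists>t. z4_inner u (f b) = double t" by (metis red2_eq_0E)
  qed
  then obtain h where h: "\<And>b. b \<in> B \<Longrightarrow> z4_inner u (f b) = double (h b)" by blast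
  obtain t where t: "(of_nat (euclidean_weight u) :: 8) = double_z8 (double t)"
  proof -
    have "4 dvd euclidean_weight u"
      by (rule mod_0_imp_dvd) (use euclidean_weight_mod_4[of u] wt u in simp)
    then obtain m where m: "euclidean_weight u = 4 * m" by blast
    have "(of_nat (4 * m) :: 8) = double_z8 (double (of_bool (odd m)))"
    proof (cases "even m")
      case True
      then have "8 dvd 4 * m" by presburger
      then have "(of_nat (4 * m) :: 8) = 0" by (simp only: of_nat_z8_eq_0_iff)
      with True show ?thesis by simp
    next
      case False
      then obtain l where "m = 2 * l + 1" by (rule oddE)
      then have "(of_nat (4 * m) :: 8) = of_nat (8 * l) + 4" by simp
      moreover have "(of_nat (8 * l) :: 8) = 0" by (simp only: of_nat_z8_eq_0_iff) simp
      ultimately show ?thesis using False by simp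
    qed
    with m that show thesis by metis
  qed
  \<comment> \<open>On \<open>B\<close>, which contains \<open>1\<close>, the values are dictated by
    \<open>h\<close>. The value at \<open>a\<close> is still free; it is chosen so that
    \<open>h 1\<close> cancels and \<open>y\<close> takes the value \<open>t\<close> on
    \<open>1 + a\<close>.\<close>
  obtain y where y: "\<And>b. b \<in> insert a B \<Longrightarrow> bit_inner y b = (if b = a then h 1 + t else h b)"
    using independent_bit_inner_extend[OF B(1), of "\<lambda>b. if b = a then h 1 + t else h b"] by metis
  define w where "w = u + injection y"
  have red_w: "reduction w = a" by (simp add: w_def reduction_add u)
  have twice: "double t + double t = 0" for t by (cases t) (auto simp: z4_numerals)
  have wf: "z4_inner w (f b) = 0" if "b \<in> B" for b
  proof -
    have "b \<noteq> a" using B(2) that by blast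
    then show ?thesis unfolding w_def
      by (simp only: z4_inner_add_left z4_inner_injection f(2)[OF that] h[OF that] y[of b] that insert_iff
          if_False simp_thms twice)
  qed
  have w_dual: "z4_inner w (injection d) = 0" if "d \<in> D" for d
    using Da[OF that] red_w
    by (simp add: z4_inner_commute[of w] z4_inner_injection bit_inner_commute[of d])
  have w_adm: "w \<in> admissible C"
  proof -
    \<comment> \<open>The residues of words in \<open>C\<close> orthogonal to \<open>w\<close> form
      a subspace containing \<open>B\<close>, hence cover \<open>vec.span B\<close>. Words of
      \<open>C\<close> with equal residue differ by a doubled torsion word, to which
      \<open>w\<close> is orthogonal by \<open>w_dual\<close>.\<close>
    have "vec.subspace (reduction ` {c \<in> C. z4_inner w c = 0})"
    proof (rule vec.subspaceI)
      show "0 \<in> reduction ` {c \<in> C. z4_inner w c = 0}"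
        using code by (intro rev_image_eqI[of 0]) (auto simp: quaternary_code_iff)
      then show "k *s x \<in> reduction ` {c \<in> C. z4_inner w c = 0}"
        if "x \<in> reduction ` {c \<in> C. z4_inner w c = 0}" for k x
        using that by (cases k) (simp_all only: vector_smult_lid vector_smult_lzero)
      show "x + x' \<in> reduction ` {c \<in> C. z4_inner w c = 0}"
        if "x \<in> reduction ` {c \<in> C. z4_inner w c = 0}"
          "x' \<in> reduction ` {c \<in> C. z4_inner w c = 0}" for x x'
      proof -
        from that obtain c c' where c: "c \<in> C" "c' \<in> C" "z4_inner w c = 0" "z4_inner w c' = 0"
          "x = reduction c" "x' = reduction c'" by blast
        then have "c + c' \<in> {c \<in> C. z4_inner w c = 0}"
          using code by (simp add: quaternary_code_iff z4_inner_add_right)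
        then show ?thesis by (rule rev_image_eqI) (simp add: c reduction_add)
      qed
    qed
    moreover have "B \<subseteq> reduction ` {c \<in> C. z4_inner w c = 0}"
    proof
      fix b assume b: "b \<in> B"
      with f(1) wf have "f b \<in> {c \<in> C. z4_inner w c = 0}" by blast
      then show "b \<in> reduction ` {c \<in> C. z4_inner w c = 0}"
        by (rule rev_image_eqI) (simp only: f(2)[OF b])
    qed
    ultimately have span: "vec.span B \<subseteq> reduction ` {c \<in> C. z4_inner w c = 0}"
      by (simp add: vec.span_minimal)
    have "z4_inner w c = 0" if "c \<in> C" for c
    proof -
      have "reduction c \<in> vec.span B" using res that by (auto simp: residue_code_def)
      with span obtain c' where c': "c' \<in> C" "z4_inner w c' = 0" "reduction c = reduction c'"
        by blast
      from that c'(3) have "c \<in> {v \<in> C. reduction v = reduction c'}" by simp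
      then obtain d where "d \<in> D" "c = c' + injection d"
        unfolding torsion_coset[OF code c'(1)] tor by blast
      with c' w_dual show ?thesis by (simp add: z4_inner_add_right)
    qed
    moreover have "8 dvd euclidean_weight w"
    proof -
      have "(of_nat (euclidean_weight w) :: 8) =
          double_z8 (double t) + double_z8 (double (bit_inner y 1 + bit_inner y a))"
        unfolding w_def wt_shift[OF u] t ..
      also have "bit_inner y 1 + bit_inner y a = t"
        using y[of 1] y[of a] B(2,3) by (cases "h 1"; cases t) auto
      also have "double_z8 (double t) + double_z8 (double t) = 0"
        by (simp only: double_z8_add[symmetric] twice double_z8_simps)
      finally show ?thesis by (simp only: of_nat_z8_eq_0_iff)
    qed
    ultimately show ?thesis by (simp add: admissible_def)
  qed
  \<comment> \<open>Orthogonality to \<open>C\<close> makes \<open>y\<close> vanish on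
    \<open>1\<close>, which lies in \<open>B\<close>; the weight condition on \<open>1 + a\<close>
    then becomes orthogonality to \<open>a\<close>.\<close>
  have shift: "w + injection y \<in> admissible C \<longleftrightarrow> y \<in> dual_code (vec.span (insert a B))" for y
  proof -
    have "w + injection y \<in> admissible C \<longleftrightarrow>
        bit_inner y 1 + bit_inner y a = 0 \<and> (\<forall>c\<in>C. bit_inner y (reduction c) = 0)"
      using w_adm wt_shift[OF red_w, of y]
      by (auto simp: admissible_def z4_inner_add_left z4_inner_injection double_eq_0_iff
          double_z8_eq_0_iff simp flip: of_nat_z8_eq_0_iff)
    also have "(\<forall>c\<in>C. bit_inner y (reduction c) = 0) \<longleftrightarrow> (\<forall>e\<in>vec.span B. bit_inner y e = 0)"
      unfolding res[symmetric] residue_code_def by simp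
    also have "\<dots> \<longleftrightarrow> y \<in> dual_code (vec.span B)"
      by (simp add: dual_code_iff bit_inner_commute[of y])
    finally show ?thesis
      using B(3) by (auto simp: dual_code_span bit_inner_commute[of y])
  qed
  have "{v \<in> admissible C. reduction v = a} =
      (\<lambda>y. w + injection y) ` dual_code (vec.span (insert a B))"
  proof (intro set_eqI iffI)
    fix v assume v: "v \<in> {v \<in> admissible C. reduction v = a}"
    then have "reduction (v - w) = 0" by (simp add: reduction_diff red_w add_self_bit_vec)
    then obtain d where "v - w = injection d" by (rule reduction_eq_0E)
    then have "v = w + injection d" by (simp add: algebra_simps)
    with v shift show "v \<in> (\<lambda>y. w + injection y) ` dual_code (vec.span (insert a B))" by blast
  qed (use shift red_w in \<open>auto simp: reduction_add\<close>)
  moreover have "inj (\<lambda>y. w + injection y)"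
    using inj_injection by (auto simp: inj_on_def)
  ultimately show ?thesis
    by (simp add: card_image inj_on_subset)
qed

section \<open>Counting the codes by induction on the residue code\<close>

text \<open>Double counting of the marked pairs in \<open>bij_betw_adjoin\<close>: each larger code
  has \<open>card D\<close> marked lifts, each smaller one as many as the dual of the larger span
  has words.\<close>

lemma card_even_lifts_insert:
  fixes a :: "bit ^ 'n" and B D :: "(bit ^ 'n) set"
  assumes B: "vec.independent (insert a B)" "a \<notin> B" "1 \<in> B"
    and D: "vec.span (insert a B) \<subseteq> D" "D \<subseteq> dual_code (vec.span (insert a B))"
    and wt: "4 dvd hamming_weight a"
  shows "card {C \<in> even_lifts (vec.span (insert a B)) D. 1 \<in> C} * card D * 2 ^ card (insert a B) =
    card {C \<in> even_lifts (vec.span B) D. 1 \<in> C} * 2 ^ CARD('n)"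
    (is "card ?T * _ * _ = card ?S * _")
proof -
  have aD: "a \<in> D" using D(1) vec.span_base[of a "insert a B"] by blast
  have a: "a \<notin> vec.span B" using B by (simp add: vec.independent_insert)
  have orth: "a \<in> dual_code (vec.span B)"
    using subsetD[OF D(2) aD] by (simp add: dual_code_span)
  have "card ?T * card D = card (SIGMA C : ?T. {u \<in> C. reduction u = a})"
  proof -
    have "card {u \<in> C. reduction u = a} = card D" if "C \<in> ?T" for C
    proof -
      have C: "quaternary_code C" "residue_code C = vec.span (insert a B)" "torsion_code C = D"
        using that by (simp_all add: even_lifts_def even_code_def)
      then show ?thesis
        using card_torsion_coset[OF C(1), of a] vec.span_base[of a "insert a B"] by simp
    qed
    then show ?thesis by simp
  qed
  also have "\<dots> = card (SIGMA C : ?S. {u \<in> admissible C. reduction u = a})"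
    using bij_betw_adjoin[OF vec.subspace_span vec.span_base[OF B(3)] a aD]
    by (subst span_insert_bit) (rule bij_betw_same_card[symmetric])
  also have "\<dots> = card ?S * card (dual_code (vec.span (insert a B)))"
    using card_admissible[OF B _ D(2) orth wt] by simp
  finally show ?thesis
    using card_dual_code_span[OF B(1)] by simp
qed

text \<open>Above 0 such a code is the doubled \<open>D\<close>, above \<open>1\<close> the coset of
  \<open>1\<close>, so it is unique. It exists because words orthogonal to \<open>1\<close> have
  even weight, whence their doubles have weight divisible by 8, and the weight of \<open>1\<close>
  is the length.\<close>

lemma card_even_lifts_span_1:
  fixes D :: "(bit ^ 'n) set"
  assumes D: "vec.subspace D" "1 \<in> D" "D \<subseteq> dual_code {1}" and n: "8 dvd CARD('n)"
  shows "card {C \<in> even_lifts (vec.span {1}) D. 1 \<in> C} = 1"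
proof -
  have span: "vec.span {1} = {0} \<union> (+) 1 ` {0 :: bit ^ 'n}"
    using span_insert_bit[of 1 "{}"] by simp
  have wt: "bit_inner d 1 = 0" if "d \<in> D" for d
    using that D(3) by (auto simp: dual_code_iff bit_inner_commute[of 1])
  have "8 dvd euclidean_weight (injection d)" if "d \<in> D" for d
    using euclidean_weight_injection[of d] wt[OF that] by (simp flip: of_nat_z8_eq_0_iff)
  moreover have "torsion_code (injection ` D) = D"
    unfolding torsion_code_def by (rule inj_vimage_image_eq[OF inj_injection])
  ultimately have "injection ` D \<in> even_lifts {0} D"
    using vec.subspace_0[OF D(1)] vec.subspace_add[OF D(1)]
    by (auto simp: even_lifts_def even_code_def quaternary_code_iff residue_code_def
        image_image simp flip: injection_add injection_0 intro!: image_eqI[of _ _ 0])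
  then have "injection ` D \<union> (+) 1 ` injection ` D \<in> even_lifts (vec.span {1}) D"
    unfolding span
  proof (rule even_lift_adjoin[where u = 1, unfolded reduction_1])
    show "z4_inner 1 c = 0" if "c \<in> injection ` D" for c
      using that wt by (auto simp: z4_inner_commute[of 1] z4_inner_injection)
  qed (use D(2) n in simp_all)
  moreover have "1 \<in> (+) 1 ` injection ` D"
  proof (rule rev_image_eqI)
    show "0 \<in> injection ` D" by (rule rev_image_eqI[OF vec.subspace_0[OF D(1)]]) simp
  qed simp
  moreover have "C = injection ` D \<union> (+) 1 ` injection ` D"
    if "C \<in> even_lifts (vec.span {1}) D" "1 \<in> C" for C
  proof -
    have C: "quaternary_code C" "0 \<in> C" "torsion_code C = D" "residue_code C = {0, 1}"
      using that by (auto simp: even_lifts_def even_code_def quaternary_code_iff span)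
    then have "C = {v \<in> C. reduction v = reduction 0} \<union> {v \<in> C. reduction v = reduction 1}"
      by (auto simp: residue_code_def)
    then show ?thesis
      unfolding torsion_coset[OF C(1,2)] torsion_coset[OF C(1) that(2)] C(3)
      by (simp add: image_image)
  qed
  ultimately have "{C \<in> even_lifts (vec.span {1}) D. 1 \<in> C} =
      {injection ` D \<union> (+) 1 ` injection ` D}"
    by blast
  then show ?thesis by simp
qed

text \<open>Starting from a single code, the step to residue dimension \<open>i + 1\<close> adds
  \<open>CARD('n) - vec.dim D - 1 - i\<close> to the exponent; these terms are summed over
  \<open>i\<close> from 1 to \<open>card B\<close>.\<close>

lemma card_even_lifts_span:
  fixes B D :: "(bit ^ 'n) set"
  assumes B: "vec.independent (insert 1 B)" "1 \<notin> B"
    and D: "vec.subspace D" "vec.span (insert 1 B) \<subseteq> D" "D \<subseteq> dual_code (vec.span (insert 1 B))"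
    and wt: "\<And>b. b \<in> B \<Longrightarrow> 4 dvd hamming_weight b" and n: "8 dvd CARD('n)"
  shows "real (card {C \<in> even_lifts (vec.span (insert 1 B)) D. 1 \<in> C}) =
    2 powr (real (card B) * (real CARD('n) - real (vec.dim D) - 1)
      - real (card B) * (real (card B) + 1) / 2)"
proof -
  have "finite B" by simp
  then show ?thesis using B D(2,3) wt
  proof (induction B)
    case empty
    then have "1 \<in> D" "D \<subseteq> dual_code {1}"
      using vec.span_base[of 1 "{1}"] by (auto simp: dual_code_iff)
    then show ?case using card_even_lifts_span_1[OF D(1) _ _ n] by simp
  next
    case (insert a B)
    have comm: "insert 1 (insert a B) = insert a (insert 1 B)" by blast
    have sub: "vec.span (insert 1 B) \<subseteq> vec.span (insert a (insert 1 B))"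
      by (rule vec.span_mono) blast
    have IH: "real (card {C \<in> even_lifts (vec.span (insert 1 B)) D. 1 \<in> C}) =
        2 powr (real (card B) * (real CARD('n) - real (vec.dim D) - 1)
          - real (card B) * (real (card B) + 1) / 2)" (is "?s = 2 powr ?e")
    proof (rule insert.IH)
      show "vec.independent (insert 1 B)"
        using insert.prems(1) unfolding comm by (rule vec.independent_mono) blast
      \<comment> \<open>Taking duals reverses inclusion, so the fixed \<open>D\<close> also fits the
        smaller residue code.\<close>
      show "D \<subseteq> dual_code (vec.span (insert 1 B))"
        using insert.prems(4) sub unfolding comm by (auto simp: dual_code_iff subset_iff)
    qed (use insert.prems sub comm in auto)
    let ?t = "real (card {C \<in> even_lifts (vec.span (insert a (insert 1 B))) D. 1 \<in> C})"
    \<comment> \<open>Both \<open>a\<close> and \<open>1\<close> come on top of \<open>B\<close>, so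
      the enlarged residue code has dimension \<open>card B + 2\<close>.\<close>
    have card: "card (insert a (insert 1 B)) = card B + 2"
      using insert.hyps insert.prems by simp
    have "card {C \<in> even_lifts (vec.span (insert a (insert 1 B))) D. 1 \<in> C} * 2 ^ vec.dim D *
        2 ^ (card B + 2) = card {C \<in> even_lifts (vec.span (insert 1 B)) D. 1 \<in> C} * 2 ^ CARD('n)"
      unfolding card[symmetric] card_subspace_bit[OF D(1), symmetric]
    proof (rule card_even_lifts_insert)
      show "a \<notin> insert 1 B" using insert.hyps insert.prems by blast
    qed (use insert.prems comm in auto)
    from arg_cong[OF this, of real]
    have "?t * 2 ^ vec.dim D * 2 ^ (card B + 2) = ?s * 2 ^ CARD('n)"
      by (simp only: of_nat_mult of_nat_power of_nat_numeral)
    then have "?t = ?s * 2 ^ CARD('n) / (2 ^ vec.dim D * 2 ^ (card B + 2))"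
      by (simp add: field_simps)
    also have "\<dots> = 2 powr (?e + real CARD('n) - (real (vec.dim D) + real (card B + 2)))"
      unfolding IH by (simp only: powr_add powr_diff powr_realpow[symmetric] zero_less_numeral)
    also have "?e + real CARD('n) - (real (vec.dim D) + real (card B + 2)) =
        real (card (insert a B)) * (real CARD('n) - real (vec.dim D) - 1)
          - real (card (insert a B)) * (real (card (insert a B)) + 1) / 2"
      using insert.hyps by (simp add: field_simps)
    finally show ?case unfolding comm .
  qed
qed

theorem theorem5p6:
  fixes C\<^sub>1 C\<^sub>2 :: "(bit ^ 'n) set" and n k\<^sub>1 k\<^sub>2 :: nat
  assumes "n = CARD('n)" and "n > 0" and "8 dvd n"
    and "binary_code C\<^sub>1" and "binary_code C\<^sub>2"
    and "C\<^sub>1 \<subseteq> C\<^sub>2" and "C\<^sub>2 \<subseteq> dual_code C\<^sub>1"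
    and "doubly_even C\<^sub>1" and "1 \<in> C\<^sub>1"
    and "vec.dim C\<^sub>1 = k\<^sub>1" and "vec.dim C\<^sub>2 = k\<^sub>1 + k\<^sub>2"
  shows "real (card {C :: (z4 ^ 'n) set. even_code C \<and> 1 \<in> C \<and>
            residue_code C = C\<^sub>1 \<and> torsion_code C = C\<^sub>2}) =
    2 powr ((real k\<^sub>1 - 1) * (2 * real n - 3 * real k\<^sub>1 - 2 - 2 * real k\<^sub>2) / 2)"
proof -
  have sub: "vec.subspace C\<^sub>1" "vec.subspace C\<^sub>2"
    using assms(4,5) by (simp_all add: binary_code_def)
  \<comment> \<open>A basis of \<open>C\<^sub>1\<close> through \<open>1\<close> is chosen; its
    other vectors are the ones adjoined one at a time.\<close>
  have "vec.independent {1 :: bit ^ 'n}"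
    by (simp add: vec.independent_insert vec_eq_iff)
  then obtain B\<^sub>1 where B\<^sub>1: "{1} \<subseteq> B\<^sub>1" "B\<^sub>1 \<subseteq> C\<^sub>1" "vec.independent B\<^sub>1" "C\<^sub>1 \<subseteq> vec.span B\<^sub>1"
    using vec.maximal_independent_subset_extend[of "{1}" C\<^sub>1] assms(9) by blast
  define B where "B = B\<^sub>1 - {1}"
  have B: "B\<^sub>1 = insert 1 B" "1 \<notin> B" using B\<^sub>1(1) by (auto simp: B_def)
  have span: "vec.span (insert 1 B) = C\<^sub>1"
    using B\<^sub>1 B sub(1) vec.span_minimal by blast
  have "card (insert 1 B) = k\<^sub>1"
    using vec.basis_card_eq_dim[OF B\<^sub>1(2,4,3)] assms(10) B by simp
  then have k\<^sub>1: "real k\<^sub>1 = real (card B) + 1" using B(2) by simp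
  have "{C. even_code C \<and> 1 \<in> C \<and> residue_code C = C\<^sub>1 \<and> torsion_code C = C\<^sub>2} =
      {C \<in> even_lifts (vec.span (insert 1 B)) C\<^sub>2. 1 \<in> C}"
    by (auto simp: even_lifts_def span)
  moreover have "real (card {C \<in> even_lifts (vec.span (insert 1 B)) C\<^sub>2. 1 \<in> C}) =
    2 powr (real (card B) * (real CARD('n) - real (vec.dim C\<^sub>2) - 1)
      - real (card B) * (real (card B) + 1) / 2)"
  proof (rule card_even_lifts_span)
    show "4 dvd hamming_weight b" if "b \<in> B" for b
      using that B\<^sub>1(2) B assms(8) by (auto simp: doubly_even_def)
  qed (use B B\<^sub>1(3) sub(2) span assms in auto)
  \<comment> \<open>With \<open>card B\<close> equal to \<open>k\<^sub>1 - 1\<close>, the exponent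
    is \<open>(k\<^sub>1 - 1) * (n - k\<^sub>1 - k\<^sub>2 - 1) - (k\<^sub>1 - 1) * k\<^sub>1 /
    2\<close>.\<close>
  ultimately show ?thesis
    using assms(1,11) k\<^sub>1 by (simp add: field_simps)
qed

end
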